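(* Let $X$ be a real Banach space, let $T(\tau,t)\in\mathscr{L}(X)$, $0\le t\le\tau$, be a strongly continuous evolution operator, and let $I_t^-,I_t^+:X\to[0,\infty)$, $t\ge0$, be two families of homogeneous (not necessarily linear) functionals such that $I_t^\pm(v)$ is continuous in $(t,v)\in[0,\infty)\times X$. Assume that there exist $c_1>0$, $c_2>0$, $K\in\{0,1,2,\ldots\}$, $\alpha_{k,t}^+\in X^*$ for $(k,t)\in\{1,\ldots,K\}\times[0,\infty)$, $c_3,c_4>0$ and $-\infty<\lambda<\mu<\infty$ such that: \begin{enumerate} \item $c_1\|v\|_X\le I_t^-(v)+I_t^+(v)\le\frac1{c_1}\|v\|_X$ for all $t\ge0$, $v\in X$; \item $c_2\max_{1\le k\le K}|\langle\alpha_{k,t}^+,v\rangle|\le I_t^+(v)\le\frac1{c_2}\max_{1\le k\le K}|\langle\alpha_{k,t}^+,v\rangle|$ for all $t\ge0$, $v\in X$; \item $\mathcal{V}_{\mathrm u}(c_3,t)$ contains a linear space of dimension $K$ for all $t\ge0$; \item $c_4<\frac13(c_1c_2)^2\frac{c_3}{1+c_3}$; \item for all $0\le t\le\tau$ and $v_t\in X$, $I_\tau^-(T(\tau,t)v_t)\le e^{\lambda(\tau-t)}I_t^-(v_t)$ whenever $T(t',t)v_t\in\mathcal{V}_{\mathrm s}(c_3,t')$ for all $t'\in[t,\tau]$; \item for all $0\le t\le\tau$ and $v_t\in X$, $I_\tau^+(T(\tau,t)v_t)\ge e^{\mu(\tau-t)}I_t^+(v_t)$ whenever $T(t',t)v_t\in\mathcal{V}_{\mathrm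 u}(c_4,t')$ for all $t'\in[t,\tau]$. \end{enumerate} Then the system $v_\tau=T(\tau,t)v_t$ has an exponential dichotomy with exponents $\lambda$ and $\mu$. For all $t\ge0$ the stable space $X_{\mathrm s}(t)$ is contained in $\mathcal{V}_{\mathrm s}(c_4,t)$ and has codimension $K$.
   Context: $\mathscr{L}(X)$ denotes bounded linear operators on $X$. Homogeneous means $I(\lambda v)=|\lambda|I(v)$ for $\lambda\in\mathbb{R}$. A maximum over an empty index set is $0$. A family $T(\tau,t)\in\mathscr{L}(X)$, $0\le t\le\tau$, is a strongly continuous evolution operator if (1) $T(t,t)=\mathrm{Id}$ for all $t\ge0$; (2) for all $t\ge0$ and $v_t\in X$ the function $[t,\infty)\ni\tau\mapsto T(\tau,t)v_t\in X$ is continuous; (3) $T(\tau,s)\circ T(s,t)=T(\tau,t)$ for $0\le t\le s\le\tau$. Cones: for $c>0$, $\mathcal{V}_{\mathrm s}(c,t):=\{v\in X:I_t^+(v)\le cI_t^-(v)\}$, $\mathcal{V}_{\mathrm u}(c,t):=\{v\in X:I_t^+(v)\ge cI_t^-(v)\}$. Exponential dichotomy with exponents $\lambda<\mu$: for all $t\ge0$ there is a direct sum decomposition $X=X_{\mathrm s}(t)\oplus X_{\mathrm u}(t)$ with associated projections $\pi_{\mathrm s}(t),\pi_{\mathrm u}(t)$ onto $X_{\mathrm s}(t),X_{\mathrm u}(t)$, and a constant $C$, such that for all $0\le t\le\tau$: (1) $T(\tau,t)\circ\pi_{\mathrm s}(t)=\pi_{\mathrm s}(\tau)\circ T(\tau,t)$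 and $T(\tau,t)\circ\pi_{\mathrm u}(t)=\pi_{\mathrm u}(\tau)\circ T(\tau,t)$; (2) $\|\pi_{\mathrm s}(t)\|_{\mathscr{L}(X)}+\|\pi_{\mathrm u}(t)\|_{\mathscr{L}(X)}\le C$; (3) $T(\tau,t)|_{X_{\mathrm u}(t)}:X_{\mathrm u}(t)\to X_{\mathrm u}(\tau)$ is invertible; (4) $\|T(\tau,t)v_t\|\le Ce^{\lambda(\tau-t)}\|v_t\|$ for all $v_t\in X_{\mathrm s}(t)$; (5) $\|T(\tau,t)^{-1}v_\tau\|\le Ce^{\mu(t-\tau)}\|v_\tau\|$ for all $v_\tau\in X_{\mathrm u}(\tau)$, where $T(\tau,t)^{-1}$ is the inverse of the restriction in (3). $X_{\mathrm s}(t)$ is called the stable subspace. *)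

theory Defs
  imports "HOL-Analysis.Analysis"
begin

text \<open>
  Families indexed by \<open>t \<ge> 0\<close> are total functions of a real parameter; their values outside
  \<open>t \<ge> 0\<close> (respectively \<open>0 \<le> t \<le> \<tau>\<close>) are never constrained or used. Bounded operators and
  functionals are elements of the type of bounded linear functions, whose norm is the operator norm.
\<close>

definition strongly_continuous_evolution ::
    "(real \<Rightarrow> real \<Rightarrow> 'a::banach \<Rightarrow>\<^sub>L 'a) \<Rightarrow> bool" where
  "strongly_continuous_evolution T \<longleftrightarrow>
     (\<forall>t\<ge>0. T t t = id_blinfun) \<and>
     (\<forall>t\<ge>0. \<forall>v. continuous_on {t..} (\<lambda>\<tau>. blinfun_apply (T \<tau> t) v)) \<and>
     (\<forall>t s \<tau>. 0 \<le> t \<and> t \<le> s \<and> s \<le> \<tau> \<longrightarrow> T \<tau> s o\<^sub>L T s t = T \<tau> t)"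

definition homogeneous :: "('a::real_vector \<Rightarrow> real) \<Rightarrow> bool" where
  "homogeneous I \<longleftrightarrow> (\<forall>r v. I (r *\<^sub>R v) = \<bar>r\<bar> * I v)"

definition stable_cone ::
    "(real \<Rightarrow> 'a \<Rightarrow> real) \<Rightarrow> (real \<Rightarrow> 'a \<Rightarrow> real) \<Rightarrow> real \<Rightarrow> real \<Rightarrow> 'a set" where
  "stable_cone Iminus Iplus c t = {v. Iplus t v \<le> c * Iminus t v}"

definition unstable_cone ::
    "(real \<Rightarrow> 'a \<Rightarrow> real) \<Rightarrow> (real \<Rightarrow> 'a \<Rightarrow> real) \<Rightarrow> real \<Rightarrow> real \<Rightarrow> 'a set" where
  "unstable_cone Iminus Iplus c t = {v. Iplus t v \<ge> c * Iminus t v}"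

text \<open>The maximum of \<open>\<bar>\<langle>\<alpha> k t, v\<rangle>\<bar>\<close> over \<open>1 \<le> k \<le> K\<close>; the maximum over the empty index set is \<open>0\<close>.\<close>

definition max_pairing ::
    "nat \<Rightarrow> (nat \<Rightarrow> real \<Rightarrow> 'a::real_normed_vector \<Rightarrow>\<^sub>L real) \<Rightarrow> real \<Rightarrow> 'a \<Rightarrow> real" where
  "max_pairing K \<alpha> t v =
     (if K = 0 then 0 else Max ((\<lambda>k. \<bar>blinfun_apply (\<alpha> k t) v\<bar>) ` {1..K}))"

text \<open>
  The library function \<open>dim\<close> is \<open>0\<close> on infinite-dimensional spaces, so finite dimension is
  expressed by the existence of a finite basis.
\<close>

definition has_dimension :: "'a::real_vector set \<Rightarrow> nat \<Rightarrow> bool" where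
  "has_dimension W n \<longleftrightarrow> (\<exists>B. finite B \<and> independent B \<and> span B = W \<and> card B = n)"

definition direct_sum :: "'a::real_vector set \<Rightarrow> 'a set \<Rightarrow> bool" where
  "direct_sum S U \<longleftrightarrow>
     subspace S \<and> subspace U \<and> S \<inter> U = {0} \<and> (\<forall>v. \<exists>s\<in>S. \<exists>u\<in>U. v = s + u)"

text \<open>Codimension is the dimension of an algebraic complement.\<close>

definition has_codimension :: "'a::real_vector set \<Rightarrow> nat \<Rightarrow> bool" where
  "has_codimension S n \<longleftrightarrow> (\<exists>W. direct_sum S W \<and> has_dimension W n)"

text \<open>
  The projections associated with \<open>X = Xs t \<oplus> Xu t\<close> are the unique maps \<open>Ps t\<close>, \<open>Pu t\<close> with
  \<open>Ps t v \<in> Xs t\<close>, \<open>Pu t v \<in> Xu t\<close> and \<open>Ps t v + Pu t v = v\<close>.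
\<close>

definition exponential_dichotomy ::
    "(real \<Rightarrow> real \<Rightarrow> 'a::banach \<Rightarrow>\<^sub>L 'a) \<Rightarrow> real \<Rightarrow> real \<Rightarrow>
     (real \<Rightarrow> 'a set) \<Rightarrow> (real \<Rightarrow> 'a set) \<Rightarrow> bool" where
  "exponential_dichotomy T lam mu Xs Xu \<longleftrightarrow>
     lam < mu \<and>
     (\<forall>t\<ge>0. direct_sum (Xs t) (Xu t)) \<and>
     (\<exists>(Ps :: real \<Rightarrow> 'a \<Rightarrow>\<^sub>L 'a) (Pu :: real \<Rightarrow> 'a \<Rightarrow>\<^sub>L 'a) (C::real).
        (\<forall>t\<ge>0. \<forall>v. blinfun_apply (Ps t) v \<in> Xs t \<and> blinfun_apply (Pu t) v \<in> Xu t \<and>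
                    blinfun_apply (Ps t) v + blinfun_apply (Pu t) v = v) \<and>
        (\<forall>t \<tau>. 0 \<le> t \<and> t \<le> \<tau> \<longrightarrow>
           T \<tau> t o\<^sub>L Ps t = Ps \<tau> o\<^sub>L T \<tau> t \<and>
           T \<tau> t o\<^sub>L Pu t = Pu \<tau> o\<^sub>L T \<tau> t \<and>
           norm (Ps t) + norm (Pu t) \<le> C \<and>
           bij_betw (blinfun_apply (T \<tau> t)) (Xu t) (Xu \<tau>) \<and>
           (\<forall>v\<in>Xs t. norm (blinfun_apply (T \<tau> t) v) \<le> C * exp (lam * (\<tau> - t)) * norm v) \<and>
           (\<forall>v\<in>Xu \<tau>. norm (inv_into (Xu t) (blinfun_apply (T \<tau> t)) v)
                        \<le> C * exp (mu * (t - \<tau>)) * norm v)))"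

end

theory Submission
  imports Defs
begin

text \<open>
  The ratio \<open>I\<^sup>+ / I\<^sup>-\<close> cannot drop along an orbit while it lies between \<open>c4\<close> and \<open>c3\<close>,
  because there the numerator grows at rate at least \<open>mu\<close> and the denominator at rate at most
  \<open>lam < mu\<close>. Hence the unstable cones of opening in \<open>(c4, c3]\<close> are forward invariant and the stable
  cone of opening \<open>c4\<close> is backward invariant (\<open>unstable_cone_forward\<close>, \<open>stable_cone_backward\<close>).
  Consequently a vector whose orbit stays in the stable cone decays at rate \<open>lam\<close>, while an orbit
  that leaves it grows at rate \<open>mu\<close> from then on.

  The stable space is taken to be the set of all vectors whose orbit is eventually bounded by a
  multiple of \<open>exp (lam * \<tau>)\<close>. This is visibly a linear space that is compatible with the flow, and
  the dichotomy just described identifies it with the set of vectors whose whole orbit stays in the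
  stable cone (\<open>Xs_iff\<close>). The unstable space is not canonical: any \<open>K\<close>-dimensional space inside the
  cone at time \<open>0\<close> is transported by the flow, which is injective on the unstable cone.

  The substance is that the two spaces span. Fix \<open>t\<close> and a later time \<open>\<tau>\<close>. The \<open>K\<close> functionals
  \<open>\<alpha> k \<tau> \<circ> T \<tau> t\<close> separate the points of the \<open>K\<close>-dimensional unstable space, so every \<open>v\<close> can be
  corrected by some \<open>w\<close> in the unstable space such that \<open>I\<^sup>+\<close> vanishes on \<open>v - w\<close> at time \<open>\<tau>\<close>;
  then \<open>v - w\<close> lies in the stable cone on all of \<open>[t, \<tau>]\<close>. For two such times \<open>\<sigma> \<le> \<tau>\<close> the
  difference of the corrections grows at rate \<open>mu\<close> up to time \<open>\<sigma>\<close> but is there dominated by a vector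
  decaying at rate \<open>lam\<close>; so the corrections form a Cauchy sequence as \<open>\<tau>\<close> tends to infinity
  (\<open>truncations_close\<close>), and the limit splits \<open>v\<close>. The smallness of \<open>c4\<close> enters through
  \<open>norm_unstable_part_le\<close>: it separates the two cones quantitatively, although the functionals
  are not linear, and bounds the projections uniformly in time.
\<close>

section \<open>Finite-dimensional spaces and separating functionals\<close>

text \<open>
  Combining the \<open>K\<close> functionals with a basis of \<open>W\<close> as coefficients gives a linear map into \<open>W\<close>. It is
  injective on \<open>W\<close> because the functionals separate points, hence maps \<open>W\<close> onto itself. Encoding the
  target as \<open>W\<close> avoids a coordinate space whose dimension would have to be a type.
\<close>

lemma functionals_interpolate:
  fixes f :: "nat \<Rightarrow> 'a::real_vector \<Rightarrow> real"
  assumes dim: "has_dimension W K"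
    and lin: "\<And>k. k \<in> {1..K} \<Longrightarrow> linear (f k)"
    and sep: "\<And>w. w \<in> W \<Longrightarrow> \<forall>k\<in>{1..K}. f k w = 0 \<Longrightarrow> w = 0"
  shows "\<exists>w\<in>W. \<forall>k\<in>{1..K}. f k w = c k"
proof -
  obtain B where B: "finite B" "independent B" "span B = W" "card B = K"
    using dim by (auto simp: has_dimension_def)
  obtain b where b: "bij_betw b {1..K} B"
    using ex_bij_betw_nat_finite_1[OF B(1)] B(4) by auto
  have bB: "b k \<in> B" if "k \<in> {1..K}" for k
    using b that by (auto simp: bij_betw_def)
  have coeff: "g k = 0" if s: "(\<Sum>k\<in>{1..K}. g k *\<^sub>R b k) = 0" and k: "k \<in> {1..K}" for g k
  proof -
    let ?h = "\<lambda>x. g (inv_into {1..K} b x)"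
    have inv: "inv_into {1..K} b (b j) = j" if "j \<in> {1..K}" for j
      using b that by (simp add: bij_betw_def)
    have "(\<Sum>x\<in>B. ?h x *\<^sub>R x) = (\<Sum>k\<in>{1..K}. ?h (b k) *\<^sub>R b k)"
      by (rule sum.reindex_bij_betw[OF b, symmetric])
    also have "\<dots> = 0" using s inv by simp
    finally have "?h (b k) = 0"
      using independentD[OF B(2) B(1) order_refl, of ?h "b k"] bB[OF k] by simp
    then show ?thesis using inv k by simp
  qed
  define L where "L v = (\<Sum>k\<in>{1..K}. f k v *\<^sub>R b k)" for v
  have L: "linear L"
    unfolding L_def
  proof (rule linearI)
    show "(\<Sum>k\<in>{1..K}. f k (x + y) *\<^sub>R b k) =
        (\<Sum>k\<in>{1..K}. f k x *\<^sub>R b k) + (\<Sum>k\<in>{1..K}. f k y *\<^sub>R b k)" for x y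
      unfolding sum.distrib[symmetric] scaleR_add_left[symmetric]
      by (intro sum.cong refl) (simp add: linear_add[OF lin])
    show "(\<Sum>k\<in>{1..K}. f k (r *\<^sub>R x) *\<^sub>R b k) = r *\<^sub>R (\<Sum>k\<in>{1..K}. f k x *\<^sub>R b k)" for r x
      unfolding scaleR_sum_right
      by (intro sum.cong refl) (simp add: linear_scale[OF lin])
  qed
  have LW: "L v \<in> W" for v
    unfolding L_def B(3)[symmetric] by (intro span_sum span_scale span_base bB)
  have inj: "inj_on L (span B)"
    unfolding linear_inj_on_iff_eq_0[OF L subspace_span]
  proof (intro ballI impI)
    fix w assume w: "w \<in> span B" "L w = 0"
    have "f k w = 0" if "k \<in> {1..K}" for k
      using coeff[of "\<lambda>k. f k w", OF _ that] w(2) by (simp add: L_def)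
    then show "w = 0" using sep[of w] w(1) B(3) by blast
  qed
  \<comment> \<open>A linear self-map of \<open>W\<close> that is injective is onto, by counting a basis.\<close>
  have "span B \<subseteq> span (L ` B)"
  proof
    fix x assume x: "x \<in> span B"
    have ind: "independent (L ` B)"
      by (rule linear_independent_injective_image[OF L B(2) inj])
    have card: "card (L ` B) = card B"
      by (rule card_image[OF inj_on_subset[OF inj span_superset]])
    show "x \<in> span (L ` B)"
    proof (rule ccontr)
      assume nx: "x \<notin> span (L ` B)"
      have "independent (insert x (L ` B))"
        using ind nx by (simp add: independent_insert)
      moreover have "insert x (L ` B) \<subseteq> span B"
        using x LW B(3) by auto
      ultimately have "card (insert x (L ` B)) \<le> card B"
        using independent_span_bound[OF B(1)] by blast
      moreover have "x \<notin> L ` B" using nx span_base[of x "L ` B"] by metis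
      ultimately show False using card B(1) by simp
    qed
  qed
  then have onto: "W \<subseteq> L ` W"
    by (simp add: linear_span_image[OF L] B(3))
  have "(\<Sum>k\<in>{1..K}. c k *\<^sub>R b k) \<in> W"
    unfolding B(3)[symmetric] by (intro span_sum span_scale span_base bB)
  from subsetD[OF onto this] obtain w where w: "w \<in> W" "L w = (\<Sum>k\<in>{1..K}. c k *\<^sub>R b k)"
    by auto
  have "(\<Sum>k\<in>{1..K}. (f k w - c k) *\<^sub>R b k) = 0"
    using w(2) by (simp add: L_def scaleR_diff_left sum_subtractf)
  from coeff[OF this] have "\<forall>k\<in>{1..K}. f k w = c k" by auto
  with w(1) show ?thesis by blast
qed

text \<open>
  A dual basis of the functionals defines a continuous projection with fixed point set \<open>W\<close>.
\<close>

lemma closed_of_separating_functionals: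
  fixes f :: "nat \<Rightarrow> 'a::real_normed_vector \<Rightarrow>\<^sub>L real"
  assumes dim: "has_dimension W K"
    and sep: "\<And>w. w \<in> W \<Longrightarrow> \<forall>k\<in>{1..K}. f k w = 0 \<Longrightarrow> w = 0"
  shows "closed W"
proof -
  have W: "subspace W" using dim by (auto simp: has_dimension_def)
  have "\<exists>e\<in>W. \<forall>k\<in>{1..K}. f k e = (if k = j then 1 else 0)" for j
    by (rule functionals_interpolate[OF dim])
       (auto intro: bounded_linear.linear blinfun.bounded_linear_right sep)
  then obtain e where e: "\<And>j. e j \<in> W"
    "\<And>j k. k \<in> {1..K} \<Longrightarrow> f k (e j) = (if k = j then 1 else 0)"
    by metis
  define Q where "Q v = (\<Sum>j\<in>{1..K}. f j v *\<^sub>R e j)" for v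
  have QW: "Q v \<in> W" for v
    unfolding Q_def by (intro subspace_sum[OF W] subspace_scale[OF W] e)
  have fQ: "f k (Q v) = f k v" if "k \<in> {1..K}" for k v
    using that by (simp add: Q_def blinfun.sum_right blinfun.scaleR_right e(2) if_distrib cong: if_cong)
  have Qw: "Q w = w" if "w \<in> W" for w
    using sep[of "Q w - w"] fQ subspace_diff[OF W QW that]
    by (simp add: blinfun.diff_right)
  have "W = {v. Q v = v}"
  proof (intro set_eqI iffI)
    show "v \<in> {v. Q v = v}" if "v \<in> W" for v using Qw[OF that] by simp
    show "v \<in> W" if "v \<in> {v. Q v = v}" for v using QW[of v] that by simp
  qed
  moreover have "continuous_on UNIV Q" unfolding Q_def by (intro continuous_intros)
  ultimately show ?thesis
    by (simp add: closed_Collect_eq)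
qed

section \<open>Direct sums and projections\<close>

lemma direct_sum_unique:
  assumes ds: "direct_sum S U"
    and u: "u \<in> U" "v - u \<in> S" and u': "u' \<in> U" "v - u' \<in> S"
  shows "u = u'"
proof -
  have "(v - u') - (v - u) \<in> S" "u - u' \<in> U"
    using ds u u' unfolding direct_sum_def by (blast intro: subspace_diff)+
  then have "u - u' \<in> S \<inter> U" by simp
  then have "u - u' = 0" using ds unfolding direct_sum_def by blast
  then show ?thesis by simp
qed

lemma direct_sum_bounded_projection:
  fixes S U :: "'a::real_normed_vector set"
  assumes ds: "direct_sum S U"
    and bound: "\<And>s u. s \<in> S \<Longrightarrow> u \<in> U \<Longrightarrow> norm u \<le> M * norm (s + u)"
  shows "\<exists>P :: 'a \<Rightarrow>\<^sub>L 'a. (\<forall>v. blinfun_apply P v \<in> U \<and> v - blinfun_apply P v \<in> S) \<and> norm P \<le> \<bar>M\<bar>"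
proof -
  have S: "subspace S" and U: "subspace U" using ds by (auto simp: direct_sum_def)
  have "\<exists>u. u \<in> U \<and> v - u \<in> S" for v
    using ds unfolding direct_sum_def by (metis add_diff_cancel_right')
  then obtain p where p: "\<And>v. p v \<in> U" "\<And>v. v - p v \<in> S" by metis
  have uniq: "p v = u" if "u \<in> U" "v - u \<in> S" for u v
    by (rule direct_sum_unique[OF ds p that])
  have nb: "norm (p v) \<le> \<bar>M\<bar> * norm v" for v
  proof -
    have "norm (p v) \<le> M * norm v" using bound[OF p(2) p(1), of v v] by simp
    also have "\<dots> \<le> \<bar>M\<bar> * norm v" by (intro mult_right_mono) auto
    finally show ?thesis .
  qed
  have bl: "bounded_linear p"
  proof (rule bounded_linear_intro)
    show "p (x + y) = p x + p y" for x y
      using subspace_add[OF S p(2)[of x] p(2)[of y]]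
      by (intro uniq subspace_add[OF U] p) (simp add: algebra_simps)
    show "p (r *\<^sub>R x) = r *\<^sub>R p x" for r x
      using subspace_scale[OF S p(2)[of x], of r]
      by (intro uniq subspace_scale[OF U] p) (simp add: algebra_simps)
    show "norm (p x) \<le> norm x * \<bar>M\<bar>" for x using nb[of x] by (simp add: mult.commute)
  qed
  show ?thesis
    by (rule exI[of _ "Blinfun p"])
       (auto simp: bounded_linear_Blinfun_apply[OF bl] p intro!: norm_blinfun_bound nb)
qed

section \<open>The maximum of the pairings\<close>

lemma max_pairing_ge:
  "k \<in> {1..K} \<Longrightarrow> \<bar>blinfun_apply (\<alpha> k t) v\<bar> \<le> max_pairing K \<alpha> t v"
  by (auto simp: max_pairing_def)

lemma max_pairing_le:
  "0 \<le> m \<Longrightarrow> (\<And>k. k \<in> {1..K} \<Longrightarrow> \<bar>blinfun_apply (\<alpha> k t) v\<bar> \<le> m) \<Longrightarrow> max_pairing K \<alpha> t v \<le> m"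
  by (auto simp: max_pairing_def)

lemma max_pairing_nonneg: "0 \<le> max_pairing K \<alpha> t v"
proof (cases "K = 0")
  case False
  then show ?thesis using order_trans[OF abs_ge_zero max_pairing_ge[of 1 K \<alpha> t v]] by simp
qed (simp add: max_pairing_def)

lemma max_pairing_diff:
  "max_pairing K \<alpha> t (u - v) \<le> max_pairing K \<alpha> t u + max_pairing K \<alpha> t v"
proof (rule max_pairing_le)
  fix k assume k: "k \<in> {1..K}"
  have "\<bar>blinfun_apply (\<alpha> k t) (u - v)\<bar> \<le> \<bar>blinfun_apply (\<alpha> k t) u\<bar> + \<bar>blinfun_apply (\<alpha> k t) v\<bar>" by (simp add: blinfun.diff_right)
  then show "\<bar>blinfun_apply (\<alpha> k t) (u - v)\<bar> \<le> max_pairing K \<alpha> t u + max_pairing K \<alpha> t v"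
    using max_pairing_ge[OF k, of \<alpha> t u] max_pairing_ge[OF k, of \<alpha> t v] by linarith
qed (simp add: max_pairing_nonneg)

section \<open>Invariance of the cones\<close>

text \<open>
  The relation \<open>c4 < c3\<close> makes the two families of cones overlap. For \<open>K \<ge> 1\<close> it follows from the
  smallness of \<open>c4\<close>; for \<open>K = 0\<close> it can be arranged by decreasing \<open>c4\<close>.
\<close>

locale separated_cones =
  fixes T :: "real \<Rightarrow> real \<Rightarrow> 'a::banach \<Rightarrow>\<^sub>L 'a"
    and Iminus Iplus :: "real \<Rightarrow> 'a \<Rightarrow> real"
    and \<alpha> :: "nat \<Rightarrow> real \<Rightarrow> 'a \<Rightarrow>\<^sub>L real"
    and K :: nat
    and c1 c2 c3 c4 lam mu :: real
  assumes evolution: "strongly_continuous_evolution T"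
    and Iminus_nonneg: "\<And>t v. t \<ge> 0 \<Longrightarrow> Iminus t v \<ge> 0"
    and Iplus_nonneg: "\<And>t v. t \<ge> 0 \<Longrightarrow> Iplus t v \<ge> 0"
    and Iminus_continuous: "continuous_on ({0..} \<times> UNIV) (\<lambda>(t, v). Iminus t v)"
    and Iplus_continuous: "continuous_on ({0..} \<times> UNIV) (\<lambda>(t, v). Iplus t v)"
    and c_pos: "c1 > 0" "c2 > 0" "c3 > 0" "c4 > 0"
    and exponents: "lam < mu"
    and norm_equiv: "\<And>t v. t \<ge> 0 \<Longrightarrow>
          c1 * norm v \<le> Iminus t v + Iplus t v \<and> Iminus t v + Iplus t v \<le> 1 / c1 * norm v"
    and Iplus_equiv: "\<And>t v. t \<ge> 0 \<Longrightarrow>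
          c2 * max_pairing K \<alpha> t v \<le> Iplus t v \<and> Iplus t v \<le> 1 / c2 * max_pairing K \<alpha> t v"
    and cone_dim: "\<And>t. t \<ge> 0 \<Longrightarrow>
          \<exists>W. has_dimension W K \<and> W \<subseteq> unstable_cone Iminus Iplus c3 t"
    and c4_small: "c4 < 1 / 3 * (c1 * c2)\<^sup>2 * (c3 / (1 + c3))"
    and c4_less_c3: "c4 < c3"
    and decay: "\<And>t \<tau> v. 0 \<le> t \<Longrightarrow> t \<le> \<tau> \<Longrightarrow>
          (\<And>t'. t' \<in> {t..\<tau>} \<Longrightarrow> blinfun_apply (T t' t) v \<in> stable_cone Iminus Iplus c3 t') \<Longrightarrow>
          Iminus \<tau> (blinfun_apply (T \<tau> t) v) \<le> exp (lam * (\<tau> - t)) * Iminus t v"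
    and growth: "\<And>t \<tau> v. 0 \<le> t \<Longrightarrow> t \<le> \<tau> \<Longrightarrow>
          (\<And>t'. t' \<in> {t..\<tau>} \<Longrightarrow> blinfun_apply (T t' t) v \<in> unstable_cone Iminus Iplus c4 t') \<Longrightarrow>
          Iplus \<tau> (blinfun_apply (T \<tau> t) v) \<ge> exp (mu * (\<tau> - t)) * Iplus t v"
begin

abbreviation flow :: "real \<Rightarrow> real \<Rightarrow> 'a \<Rightarrow> 'a" where
  "flow \<tau> t v \<equiv> blinfun_apply (T \<tau> t) v"

abbreviation Vs :: "real \<Rightarrow> real \<Rightarrow> 'a set" where
  "Vs \<equiv> stable_cone Iminus Iplus"

abbreviation Vu :: "real \<Rightarrow> real \<Rightarrow> 'a set" where
  "Vu \<equiv> unstable_cone Iminus Iplus"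

lemma in_Vs: "v \<in> Vs c t \<longleftrightarrow> Iplus t v \<le> c * Iminus t v"
  by (simp add: stable_cone_def)

lemma in_Vu: "v \<in> Vu c t \<longleftrightarrow> c * Iminus t v \<le> Iplus t v"
  by (simp add: unstable_cone_def)

lemma Vs_mono: "t \<ge> 0 \<Longrightarrow> c \<le> d \<Longrightarrow> v \<in> Vs c t \<Longrightarrow> v \<in> Vs d t"
  unfolding in_Vs by (meson Iminus_nonneg mult_right_mono order_trans)

lemma Vu_antimono: "t \<ge> 0 \<Longrightarrow> c \<le> d \<Longrightarrow> v \<in> Vu d t \<Longrightarrow> v \<in> Vu c t"
  unfolding in_Vu by (meson Iminus_nonneg mult_right_mono order_trans)

lemma flow_refl [simp]: "t \<ge> 0 \<Longrightarrow> flow t t v = v"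
  using evolution by (simp add: strongly_continuous_evolution_def)

lemma flow_flow: "0 \<le> t \<Longrightarrow> t \<le> s \<Longrightarrow> s \<le> \<tau> \<Longrightarrow> flow \<tau> s (flow s t v) = flow \<tau> t v"
  using evolution unfolding strongly_continuous_evolution_def
  by (metis blinfun_apply_blinfun_compose)

lemma continuous_flow: "t \<ge> 0 \<Longrightarrow> continuous_on {t..} (\<lambda>\<tau>. flow \<tau> t v)"
  using evolution by (auto simp: strongly_continuous_evolution_def)

lemma continuous_along_flow:
  assumes "t \<ge> 0"
  shows "continuous_on {t..} (\<lambda>\<tau>. Iminus \<tau> (flow \<tau> t v))"
    and "continuous_on {t..} (\<lambda>\<tau>. Iplus \<tau> (flow \<tau> t v))"
proof -
  have c: "continuous_on {t..} (\<lambda>\<tau>. (\<tau>, flow \<tau> t v))"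
    by (intro continuous_intros continuous_flow assms)
  have m: "(\<lambda>\<tau>. (\<tau>, flow \<tau> t v)) ` {t..} \<subseteq> {0..} \<times> UNIV" using assms by auto
  show "continuous_on {t..} (\<lambda>\<tau>. Iminus \<tau> (flow \<tau> t v))"
    using continuous_on_compose2[OF Iminus_continuous c m] by simp
  show "continuous_on {t..} (\<lambda>\<tau>. Iplus \<tau> (flow \<tau> t v))"
    using continuous_on_compose2[OF Iplus_continuous c m] by simp
qed

lemma continuous_in_vector:
  assumes "t \<ge> 0"
  shows "continuous_on UNIV (Iminus t)" "continuous_on UNIV (Iplus t)"
proof -
  have c: "continuous_on UNIV (\<lambda>v::'a. (t, v))" by (intro continuous_intros)
  have m: "(\<lambda>v::'a. (t, v)) ` UNIV \<subseteq> {0..} \<times> UNIV" using assms by auto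
  show "continuous_on UNIV (Iminus t)"
    using continuous_on_compose2[OF Iminus_continuous c m] by simp
  show "continuous_on UNIV (Iplus t)"
    using continuous_on_compose2[OF Iplus_continuous c m] by simp
qed

lemma closed_Vs: "t \<ge> 0 \<Longrightarrow> closed (Vs c t)"
  unfolding stable_cone_def
  by (intro closed_Collect_le continuous_intros continuous_in_vector)

lemma functionals_zero: "t \<ge> 0 \<Longrightarrow> Iminus t 0 = 0 \<and> Iplus t 0 = 0"
  using norm_equiv[of t 0] Iminus_nonneg[of t 0] Iplus_nonneg[of t 0] by auto

lemma functionals_eq_0:
  assumes "t \<ge> 0" "Iminus t v = 0" "Iplus t v = 0"
  shows "v = 0"
  using norm_equiv[of t v] assms c_pos by (simp add: mult_le_0_iff)

lemma Iminus_le: "t \<ge> 0 \<Longrightarrow> Iminus t v \<le> norm v / c1"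
  using norm_equiv[of t v] Iplus_nonneg[of t v] by simp

lemma Iplus_le: "t \<ge> 0 \<Longrightarrow> Iplus t v \<le> norm v / c1"
  using norm_equiv[of t v] Iminus_nonneg[of t v] by simp

lemma norm_le_in_Vs:
  assumes "t \<ge> 0" "v \<in> Vs c t"
  shows "norm v \<le> (1 + c) / c1 * Iminus t v"
proof -
  have "c1 * norm v \<le> (1 + c) * Iminus t v"
    using norm_equiv[of t v] assms by (simp add: in_Vs algebra_simps)
  then show ?thesis using c_pos by (simp add: field_simps)
qed

lemma norm_le_in_Vu:
  assumes "t \<ge> 0" "v \<in> Vu c3 t"
  shows "norm v \<le> (1 + c3) / (c1 * c3) * Iplus t v"
proof -
  have "c1 * norm v * c3 \<le> (Iminus t v + Iplus t v) * c3"
    using norm_equiv[of t v] assms c_pos by (intro mult_right_mono) auto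
  also have "\<dots> \<le> (1 + c3) * Iplus t v"
    using assms by (simp add: in_Vu algebra_simps)
  finally show ?thesis using c_pos by (simp add: field_simps)
qed

text \<open>
  Comparability with a maximum of linear functionals replaces the missing linearity of \<open>I\<^sup>+\<close> by
  a triangle inequality up to a constant.
\<close>

lemma Iplus_diff_le:
  assumes "t \<ge> 0"
  shows "Iplus t (u - v) \<le> (1 / c2)\<^sup>2 * (Iplus t u + Iplus t v)"
proof -
  have mp: "max_pairing K \<alpha> t w \<le> 1 / c2 * Iplus t w" for w
    using Iplus_equiv[OF assms, of w] c_pos by (simp add: field_simps)
  have "Iplus t (u - v) \<le> 1 / c2 * max_pairing K \<alpha> t (u - v)"
    using Iplus_equiv[OF assms] by blast
  also have "\<dots> \<le> 1 / c2 * (1 / c2 * Iplus t u + 1 / c2 * Iplus t v)"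
    using max_pairing_diff[of K \<alpha> t u v] mp[of u] mp[of v] c_pos
    by (intro mult_left_mono) auto
  finally show ?thesis by (simp add: power2_eq_square add_divide_distrib algebra_simps)
qed

lemma Iplus_eq_0_if:
  assumes "t \<ge> 0" "\<forall>k\<in>{1..K}. blinfun_apply (\<alpha> k t) v = 0"
  shows "Iplus t v = 0"
proof -
  have "max_pairing K \<alpha> t v \<le> 0" using assms(2) by (intro max_pairing_le) auto
  then have "1 / c2 * max_pairing K \<alpha> t v \<le> 0" using c_pos by (simp add: divide_le_0_iff)
  then show ?thesis
    using Iplus_equiv[OF assms(1), of v] Iplus_nonneg[OF assms(1), of v] by linarith
qed

text \<open>
  If an orbit left the cone, consider the last time \<open>s\<close> at which it is inside. There
  \<open>I\<^sup>+ = c * I\<^sup>-\<close>, and since \<open>c > c4\<close> the orbit stays for a short while in the region where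
  both the growth and the decay estimate hold; these force \<open>I\<^sup>+ \<ge> c * I\<^sup>-\<close> shortly after
  \<open>s\<close>, a contradiction. For \<open>c = c4\<close> the argument breaks down, as the orbit would
  be outside the region of the growth estimate immediately after \<open>s\<close>.
\<close>

lemma unstable_cone_forward:
  assumes c: "c4 < c" "c \<le> c3" and t: "0 \<le> t" "t \<le> \<tau>" and v: "v \<in> Vu c t"
  shows "flow \<tau> t v \<in> Vu c \<tau>"
proof (rule ccontr)
  define f where "f s = Iplus s (flow s t v) - c * Iminus s (flow s t v)" for s
  define g where "g s = Iplus s (flow s t v) - c4 * Iminus s (flow s t v)" for s
  have cf: "continuous_on {t..} f" and cg: "continuous_on {t..} g"
    unfolding f_def g_def by (intro continuous_intros continuous_along_flow t(1))+
  assume "flow \<tau> t v \<notin> Vu c \<tau>"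
  then have f\<tau>: "f \<tau> < 0" by (simp add: f_def in_Vu)
  have ft: "0 \<le> f t" using v t by (simp add: f_def in_Vu)
  have "compact ({t..\<tau>} \<inter> {s. f s \<in> {0..}})"
    using continuous_closed_preimage[of "{t..\<tau>}" f "{0..}"]
      continuous_on_subset[OF cf, of "{t..\<tau>}"]
    by (simp add: compact_eq_bounded_closed vimage_def bounded_Int)
  moreover have "{t..\<tau>} \<inter> {s. f s \<in> {0..}} \<noteq> {}" using ft t by auto
  ultimately obtain s where "s \<in> {t..\<tau>} \<inter> {s. f s \<in> {0..}}"
    and "\<forall>r\<in>{t..\<tau>} \<inter> {s. f s \<in> {0..}}. r \<le> s"
    by (rule compact_attains_sup[THEN bexE])
  then have s: "t \<le> s" "s \<le> \<tau>" "0 \<le> f s"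
    and max: "\<And>r. t \<le> r \<Longrightarrow> r \<le> \<tau> \<Longrightarrow> 0 \<le> f r \<Longrightarrow> r \<le> s"
    by auto
  have s0: "s \<ge> 0" using s t by simp
  \<comment> \<open>By the choice of \<open>s\<close> no zero of \<open>f\<close> lies beyond it, so the zero found is \<open>s\<close> itself.\<close>
  have "\<exists>r\<ge>s. r \<le> \<tau> \<and> f r = 0"
    using f\<tau> s by (intro IVT2') (auto intro: continuous_on_subset[OF cf])
  then obtain r where r: "s \<le> r" "r \<le> \<tau>" "f r = 0" by blast
  then have fs: "f s = 0" using max[of r] s by (simp add: antisym)
  have s\<tau>: "s < \<tau>" using fs f\<tau> s by (cases "s = \<tau>") auto
  have neg: "f r \<le> 0" if "s \<le> r" "r \<le> \<tau>" for r
    using max[of r] fs that s by (cases "r = s") force+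
  \<comment> \<open>An orbit that has reached \<open>0\<close> stays there and does not leave the cone.\<close>
  have nz: "flow s t v \<noteq> 0"
  proof
    assume "flow s t v = 0"
    then have "flow \<tau> t v = 0" using flow_flow[of t s \<tau> v] s t by (simp add: blinfun.zero_right)
    then show False using f\<tau> functionals_zero[of \<tau>] t by (simp add: f_def)
  qed
  have gs: "0 < g s"
  proof -
    have gf: "g s = f s + (c - c4) * Iminus s (flow s t v)" by (simp add: f_def g_def algebra_simps)
    have "Iminus s (flow s t v) \<noteq> 0"
      using functionals_eq_0[OF s0, of "flow s t v"] fs nz by (auto simp: f_def)
    then have "0 < Iminus s (flow s t v)" using Iminus_nonneg[OF s0, of "flow s t v"] by simp
    then show ?thesis using gf fs c by simp
  qed
  obtain d where d: "d > 0" "\<And>r. t \<le> r \<Longrightarrow> dist r s < d \<Longrightarrow> dist (g r) (g s) < g s"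
    using cg gs s(1) unfolding continuous_on_iff by (metis atLeast_iff)
  define r where "r = min \<tau> (s + d / 2)"
  have r: "s < r" "r \<le> \<tau>" "r < s + d" using s\<tau> d by (auto simp: r_def)
  have gpos: "0 \<le> g q" if "s \<le> q" "q \<le> r" for q
    using d(2)[of q] that s r by (auto simp: dist_real_def abs_if split: if_splits)
  have ff: "flow q s (flow s t v) = flow q t v" if "s \<le> q" for q
    using flow_flow[of t s q v] that s t by simp
  have dec: "Iminus r (flow r t v) \<le> exp (lam * (r - s)) * Iminus s (flow s t v)"
  proof -
    have "flow q t v \<in> Vs c3 q" if "q \<in> {s..r}" for q
      using neg[of q] that r s0 c by (intro Vs_mono[of q c c3]) (auto simp: f_def in_Vs)
    then show ?thesis using decay[of s r "flow s t v"] s0 r ff by simp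
  qed
  have gro: "exp (mu * (r - s)) * Iplus s (flow s t v) \<le> Iplus r (flow r t v)"
  proof -
    have "flow q t v \<in> Vu c4 q" if "q \<in> {s..r}" for q
      using gpos[of q] that by (auto simp: g_def in_Vu)
    then show ?thesis using growth[of s r "flow s t v"] s0 r ff by simp
  qed
  have "c * Iminus r (flow r t v) \<le> c * (exp (lam * (r - s)) * Iminus s (flow s t v))"
    using dec c c_pos by (intro mult_left_mono) auto
  also have "\<dots> = exp (lam * (r - s)) * Iplus s (flow s t v)" using fs by (simp add: f_def)
  also have "\<dots> \<le> exp (mu * (r - s)) * Iplus s (flow s t v)"
    using exponents r Iplus_nonneg[OF s0] by (intro mult_right_mono) auto
  also have "\<dots> \<le> Iplus r (flow r t v)" by (rule gro)
  finally have "0 \<le> f r" by (simp add: f_def)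
  then show False using max[of r] r s by simp
qed

lemma growth_in_Vu:
  assumes c: "c4 < c" "c \<le> c3" and t: "0 \<le> t" "t \<le> \<tau>" and v: "v \<in> Vu c t"
  shows "exp (mu * (\<tau> - t)) * Iplus t v \<le> Iplus \<tau> (flow \<tau> t v)"
proof (rule growth[OF t])
  fix s assume "s \<in> {t..\<tau>}"
  then show "flow s t v \<in> Vu c4 s"
    using unstable_cone_forward[OF c t(1) _ v, of s] Vu_antimono[of s c4 c] c t by simp
qed

text \<open>
  Openness of the complement of the stable cone provides the strict inequality that forward
  invariance needs.
\<close>

lemma outside_Vs:
  assumes t: "0 \<le> t" and v: "v \<notin> Vs c4 t"
  obtains c where "c4 < c" "c \<le> c3" "v \<in> Vu c t"
proof (cases "Iminus t v = 0")
  case True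
  then show ?thesis using that[of c3] c4_less_c3 Iplus_nonneg[OF t] by (simp add: in_Vu)
next
  case False
  then have pos: "0 < Iminus t v" using Iminus_nonneg[OF t, of v] by simp
  have "min c3 (Iplus t v / Iminus t v) * Iminus t v \<le> Iplus t v / Iminus t v * Iminus t v"
    using pos by (intro mult_right_mono) auto
  moreover have "c4 < Iplus t v / Iminus t v"
    using v pos by (simp add: in_Vs field_simps)
  ultimately show ?thesis
    using that[of "min c3 (Iplus t v / Iminus t v)"] c4_less_c3 pos by (simp add: in_Vu)
qed

lemma growth_outside_Vs:
  assumes t: "0 \<le> t" "t \<le> \<tau>" and v: "v \<notin> Vs c4 t"
  shows "0 < Iplus t v" "exp (mu * (\<tau> - t)) * Iplus t v \<le> Iplus \<tau> (flow \<tau> t v)"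
proof -
  show "0 < Iplus t v"
    using v Iminus_nonneg[OF t(1), of v] c_pos
    by (simp add: in_Vs not_le) (meson le_less_trans mult_nonneg_nonneg less_imp_le)
  show "exp (mu * (\<tau> - t)) * Iplus t v \<le> Iplus \<tau> (flow \<tau> t v)"
    using outside_Vs[OF t(1) v] growth_in_Vu[OF _ _ t] by metis
qed

text \<open>
  A vector outside the stable cone lies in an unstable cone of some opening \<open>c > c4\<close>. This cone is
  forward invariant and meets the stable cone only in \<open>0\<close>; but the orbit cannot reach \<open>0\<close>, since
  \<open>I\<^sup>+\<close> grows along it.
\<close>

lemma stable_cone_backward:
  assumes t: "0 \<le> t" "t \<le> \<tau>" and v: "flow \<tau> t v \<in> Vs c4 \<tau>"
  shows "v \<in> Vs c4 t"
proof (rule ccontr)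
  have \<tau>: "0 \<le> \<tau>" using t by simp
  assume n: "v \<notin> Vs c4 t"
  then obtain c where c: "c4 < c" "c \<le> c3" "v \<in> Vu c t" using outside_Vs[OF t(1)] by blast
  then have "c * Iminus \<tau> (flow \<tau> t v) \<le> Iplus \<tau> (flow \<tau> t v)"
    using unstable_cone_forward[OF c(1,2) t c(3)] by (simp add: in_Vu)
  moreover have "Iplus \<tau> (flow \<tau> t v) \<le> c4 * Iminus \<tau> (flow \<tau> t v)" using v by (simp add: in_Vs)
  ultimately have "(c - c4) * Iminus \<tau> (flow \<tau> t v) \<le> 0" by (simp add: algebra_simps)
  then have "Iminus \<tau> (flow \<tau> t v) = 0"
    using c(1) Iminus_nonneg[OF \<tau>, of "flow \<tau> t v"] by (simp add: mult_le_0_iff)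
  then have "Iplus \<tau> (flow \<tau> t v) \<le> 0" using v by (simp add: in_Vs)
  moreover have "0 < exp (mu * (\<tau> - t)) * Iplus t v"
    using growth_outside_Vs(1)[OF t n] by simp
  ultimately show False using growth_outside_Vs(2)[OF t n] by simp
qed

lemma decay_in_Vs:
  assumes t: "0 \<le> t" "t \<le> \<tau>" and v: "flow \<tau> t v \<in> Vs c4 \<tau>"
  shows "Iminus \<tau> (flow \<tau> t v) \<le> exp (lam * (\<tau> - t)) * Iminus t v"
proof (rule decay[OF t])
  fix s assume s: "s \<in> {t..\<tau>}"
  then have "flow s t v \<in> Vs c4 s"
    using stable_cone_backward[of s \<tau> "flow s t v"] flow_flow[of t s \<tau> v] t v by simp
  then show "flow s t v \<in> Vs c3 s" using Vs_mono[of s c4 c3] s t c4_less_c3 by simp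
qed

text \<open>
  The factor \<open>3 / 2\<close> is \<open>1 / (1 - 1 / 3)\<close>: the smallness of \<open>c4\<close> bounds by \<open>1 / 3\<close> the coefficient of
  the term that is absorbed in \<open>norm_unstable_part_le\<close>.
\<close>

definition gap_constant :: real where
  "gap_constant = 3 / 2 * ((1 + c3) / (c1 * c3) * (1 / c2)\<^sup>2 * ((1 + c4) / c1))"

lemma gap_constant_nonneg: "0 \<le> gap_constant"
  using c_pos by (simp add: gap_constant_def)

text \<open>
  The norm of \<open>w\<close> is controlled by \<open>I\<^sup>+\<close> of \<open>w = (a + w) - a\<close>, hence by \<open>I\<^sup>+\<close> of \<open>a + w\<close> and
  of \<open>a\<close>. The latter is at most \<open>c4 * I\<^sup>-\<close> of \<open>a\<close> and therefore a small multiple of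
  \<open>norm (a + w) + norm w\<close>, whose second part is absorbed on the left.
\<close>

lemma norm_unstable_part_le:
  assumes t: "t \<ge> 0" and a: "a \<in> Vs c4 t" and w: "w \<in> Vu c3 t"
  shows "norm w \<le> gap_constant * norm (a + w)"
proof -
  define r where "r = (1 + c3) / (c1 * c3) * (1 / c2)\<^sup>2"
  have r0: "0 \<le> r" using c_pos by (simp add: r_def)
  have small: "r * (c4 / c1) \<le> 1 / 3"
  proof -
    have "c4 * (3 * (1 + c3)) \<le> (c1 * c2)\<^sup>2 * c3"
      using c4_small c_pos by (simp add: field_simps)
    then show ?thesis using c_pos by (simp add: r_def field_simps power2_eq_square)
  qed
  have "norm a \<le> norm (a + w) + norm w" using norm_triangle_ineq4[of "a + w" w] by simp
  then have "Iminus t a \<le> (norm (a + w) + norm w) / c1"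
    using Iminus_le[OF t, of a] c_pos by (meson divide_right_mono less_imp_le order_trans)
  then have "c4 * Iminus t a \<le> c4 * ((norm (a + w) + norm w) / c1)"
    using c_pos by (intro mult_left_mono) auto
  then have Ia: "Iplus t a \<le> c4 * ((norm (a + w) + norm w) / c1)"
    using a by (simp add: in_Vs)
  have "norm w \<le> (1 + c3) / (c1 * c3) * Iplus t ((a + w) - a)"
    using norm_le_in_Vu[OF t w] by simp
  also have "\<dots> \<le> (1 + c3) / (c1 * c3) * ((1 / c2)\<^sup>2 * (Iplus t (a + w) + Iplus t a))"
    using c_pos by (intro mult_left_mono Iplus_diff_le t) auto
  also have "\<dots> \<le> (1 + c3) / (c1 * c3) *
      ((1 / c2)\<^sup>2 * (norm (a + w) / c1 + c4 * ((norm (a + w) + norm w) / c1)))"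
    using c_pos by (intro mult_left_mono add_mono Iplus_le t Ia) auto
  also have "\<dots> = r * ((1 + c4) / c1) * norm (a + w) + r * (c4 / c1) * norm w"
    by (simp add: r_def algebra_simps add_divide_distrib)
  also have "\<dots> \<le> r * ((1 + c4) / c1) * norm (a + w) + 1 / 3 * norm w"
    by (intro add_left_mono mult_right_mono small) auto
  finally have le: "norm w \<le> r * ((1 + c4) / c1) * norm (a + w) + 1 / 3 * norm w" .
  have absorb: "x \<le> 3 / 2 * y" if "x \<le> y + 1 / 3 * x" for x y :: real
    using that by simp
  have "norm w \<le> 3 / 2 * (r * ((1 + c4) / c1) * norm (a + w))" by (rule absorb[OF le])
  then show ?thesis by (simp only: gap_constant_def r_def mult.assoc)
qed

section \<open>The stable space\<close>

text \<open>
  Stability is expressed by a growth bound rather than by membership of the orbit in the cones, which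
  need not be convex: in this form linearity is immediate.
\<close>

definition Xs :: "real \<Rightarrow> 'a set" where
  "Xs t = {v. \<exists>C. \<forall>\<^sub>F \<tau> in at_top. norm (flow \<tau> t v) \<le> C * exp (lam * \<tau>)}"

lemma subspace_Xs: "subspace (Xs t)"
proof (rule subspaceI)
  show "0 \<in> Xs t" unfolding Xs_def by (auto simp: blinfun.zero_right intro!: exI[of _ 0])
  fix u v assume "u \<in> Xs t" "v \<in> Xs t"
  then obtain C D where
    C: "\<forall>\<^sub>F \<tau> in at_top. norm (flow \<tau> t u) \<le> C * exp (lam * \<tau>)" and
    D: "\<forall>\<^sub>F \<tau> in at_top. norm (flow \<tau> t v) \<le> D * exp (lam * \<tau>)"
    by (auto simp: Xs_def)
  have "\<forall>\<^sub>F \<tau> in at_top. norm (flow \<tau> t (u + v)) \<le> (C + D) * exp (lam * \<tau>)"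
    using C D
  proof eventually_elim
    case (elim \<tau>)
    then show ?case
      using norm_triangle_ineq[of "flow \<tau> t u" "flow \<tau> t v"]
      by (simp add: blinfun.add_right algebra_simps)
  qed
  then show "u + v \<in> Xs t" by (auto simp: Xs_def)
next
  fix r v assume "v \<in> Xs t"
  then obtain C where C: "\<forall>\<^sub>F \<tau> in at_top. norm (flow \<tau> t v) \<le> C * exp (lam * \<tau>)"
    by (auto simp: Xs_def)
  have "\<forall>\<^sub>F \<tau> in at_top. norm (flow \<tau> t (r *\<^sub>R v)) \<le> (\<bar>r\<bar> * C) * exp (lam * \<tau>)"
    using C
  proof eventually_elim
    case (elim \<tau>)
    then show ?case
      using mult_left_mono[OF elim, of "\<bar>r\<bar>"] by (simp add: blinfun.scaleR_right mult.assoc)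
  qed
  then show "r *\<^sub>R v \<in> Xs t" by (auto simp: Xs_def)
qed

lemma Xs_flow:
  assumes "0 \<le> t" "t \<le> \<tau>"
  shows "flow \<tau> t v \<in> Xs \<tau> \<longleftrightarrow> v \<in> Xs t"
proof -
  have "\<forall>\<^sub>F s in at_top. flow s \<tau> (flow \<tau> t v) = flow s t v"
    using eventually_ge_at_top[of \<tau>] by eventually_elim (simp add: flow_flow assms)
  then have "(\<forall>\<^sub>F s in at_top. norm (flow s \<tau> (flow \<tau> t v)) \<le> C * exp (lam * s)) \<longleftrightarrow>
      (\<forall>\<^sub>F s in at_top. norm (flow s t v) \<le> C * exp (lam * s))" for C
    by (intro eventually_subst) (auto elim!: eventually_mono)
  then show ?thesis by (simp add: Xs_def)
qed

lemma norm_flow_le: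
  assumes t: "0 \<le> t" "t \<le> \<tau>" and v: "flow \<tau> t v \<in> Vs c4 \<tau>"
  shows "norm (flow \<tau> t v) \<le> (1 + c4) / c1\<^sup>2 * exp (lam * (\<tau> - t)) * norm v"
proof -
  have "norm (flow \<tau> t v) \<le> (1 + c4) / c1 * Iminus \<tau> (flow \<tau> t v)"
    using norm_le_in_Vs[OF _ v] t by simp
  also have "\<dots> \<le> (1 + c4) / c1 * (exp (lam * (\<tau> - t)) * (norm v / c1))"
  proof (rule mult_left_mono)
    have "exp (lam * (\<tau> - t)) * Iminus t v \<le> exp (lam * (\<tau> - t)) * (norm v / c1)"
      by (intro mult_left_mono Iminus_le t) auto
    then show "Iminus \<tau> (flow \<tau> t v) \<le> exp (lam * (\<tau> - t)) * (norm v / c1)"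
      using decay_in_Vs[OF t v] by linarith
  qed (use c_pos in auto)
  finally show ?thesis by (simp add: power2_eq_square)
qed

text \<open>
  Orbits in the stable cone decay; conversely an orbit that is outside the cone at some time grows at
  rate \<open>mu\<close> afterwards, which no multiple of \<open>exp (lam * \<tau>)\<close> dominates.
\<close>

lemma Xs_iff:
  assumes t: "t \<ge> 0"
  shows "v \<in> Xs t \<longleftrightarrow> (\<forall>\<tau>\<ge>t. flow \<tau> t v \<in> Vs c4 \<tau>)"
proof
  assume cone: "\<forall>\<tau>\<ge>t. flow \<tau> t v \<in> Vs c4 \<tau>"
  define C where "C = (1 + c4) / c1\<^sup>2 * exp (- (lam * t)) * norm v"
  have "norm (flow \<tau> t v) \<le> C * exp (lam * \<tau>)" if "\<tau> \<ge> t" for \<tau>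
  proof -
    have "exp (lam * (\<tau> - t)) = exp (- (lam * t)) * exp (lam * \<tau>)"
      by (simp add: exp_add[symmetric] algebra_simps)
    then show ?thesis using norm_flow_le[OF t that] cone that by (simp add: C_def mult_ac)
  qed
  then have "\<forall>\<^sub>F \<tau> in at_top. norm (flow \<tau> t v) \<le> C * exp (lam * \<tau>)"
    by (auto simp: eventually_at_top_linorder)
  then show "v \<in> Xs t" by (auto simp: Xs_def)
next
  assume "v \<in> Xs t"
  then obtain C where C: "\<forall>\<^sub>F s in at_top. norm (flow s t v) \<le> C * exp (lam * s)"
    by (auto simp: Xs_def)
  show "\<forall>\<tau>\<ge>t. flow \<tau> t v \<in> Vs c4 \<tau>"
  proof (intro allI impI, rule ccontr)
    fix \<tau> assume \<tau>: "\<tau> \<ge> t"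
    define u where "u = flow \<tau> t v"
    assume "flow \<tau> t v \<notin> Vs c4 \<tau>"
    then have u: "u \<notin> Vs c4 \<tau>" by (simp add: u_def)
    have \<tau>0: "\<tau> \<ge> 0" using t \<tau> by simp
    have pos: "0 < Iplus \<tau> u" using growth_outside_Vs(1)[OF \<tau>0 order_refl u] .
    \<comment> \<open>The growth bound and the bound defining stability, divided by \<open>exp (lam * s)\<close>.\<close>
    have le: "\<forall>\<^sub>F s in at_top. exp ((mu - lam) * s) \<le> C * exp (mu * \<tau>) / (c1 * Iplus \<tau> u)"
      using C eventually_ge_at_top[of \<tau>]
    proof eventually_elim
      case (elim s)
      have "exp (mu * (s - \<tau>)) * Iplus \<tau> u \<le> Iplus s (flow s \<tau> u)"
        using growth_outside_Vs(2)[OF \<tau>0 elim(2) u] .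
      also have "\<dots> \<le> norm (flow s \<tau> u) / c1" using Iplus_le[of s "flow s \<tau> u"] elim(2) \<tau>0 by simp
      also have "flow s \<tau> u = flow s t v" unfolding u_def by (rule flow_flow[OF t \<tau> elim(2)])
      also have "norm (flow s t v) / c1 \<le> C * exp (lam * s) / c1"
        using elim c_pos by (intro divide_right_mono) auto
      finally have "c1 * (exp (mu * (s - \<tau>)) * Iplus \<tau> u) \<le> C * exp (lam * s)"
        using c_pos by (simp add: field_simps)
      then have "c1 * (exp (mu * (s - \<tau>)) * Iplus \<tau> u) * exp (mu * \<tau> - lam * s)
          \<le> C * exp (lam * s) * exp (mu * \<tau> - lam * s)"
        by (intro mult_right_mono) auto
      then have "(exp (mu * (s - \<tau>)) * exp (mu * \<tau> - lam * s)) * (c1 * Iplus \<tau> u)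
          \<le> C * (exp (lam * s) * exp (mu * \<tau> - lam * s))"
        by (simp add: mult_ac)
      then have "exp ((mu - lam) * s) * (c1 * Iplus \<tau> u) \<le> C * exp (mu * \<tau>)"
        by (simp add: exp_add[symmetric] algebra_simps)
      then show ?case using pos c_pos by (simp add: pos_le_divide_eq)
    qed
    have "filterlim (\<lambda>s. exp ((mu - lam) * s)) at_top at_top"
      using exponents
      by (intro filterlim_compose[OF exp_at_top] filterlim_tendsto_pos_mult_at_top[OF tendsto_const])
         (auto simp: filterlim_ident)
    then have "\<forall>\<^sub>F s in at_top. C * exp (mu * \<tau>) / (c1 * Iplus \<tau> u) < exp ((mu - lam) * s)"
      by (simp add: filterlim_at_top_dense)
    with le have "\<forall>\<^sub>F s in at_top. False \<and> (s::real) = s" by eventually_elim simp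
    then show False by simp
  qed
qed

lemma Xs_subset_Vs: "t \<ge> 0 \<Longrightarrow> Xs t \<subseteq> Vs c4 t"
  using Xs_iff[of t] by fastforce

section \<open>The unstable space\<close>

definition initial_unstable :: "'a set" where
  "initial_unstable = (SOME W. has_dimension W K \<and> W \<subseteq> Vu c3 0)"

definition Xu :: "real \<Rightarrow> 'a set" where
  "Xu t = blinfun_apply (T t 0) ` initial_unstable"

lemma initial_unstable: "has_dimension initial_unstable K" "initial_unstable \<subseteq> Vu c3 0"
  unfolding initial_unstable_def using someI_ex[OF cone_dim[OF order_refl]] by auto

lemma Xu_subset_Vu: "t \<ge> 0 \<Longrightarrow> Xu t \<subseteq> Vu c3 t"
  using unstable_cone_forward[OF c4_less_c3 order_refl order_refl] initial_unstable(2)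
  by (auto simp: Xu_def)

lemma norm_flow_ge:
  assumes t: "0 \<le> t" "t \<le> \<tau>" and v: "v \<in> Vu c3 t"
  shows "norm v \<le> (1 + c3) / (c1\<^sup>2 * c3) * exp (mu * (t - \<tau>)) * norm (flow \<tau> t v)"
proof -
  have "exp (mu * (\<tau> - t)) * Iplus t v \<le> norm (flow \<tau> t v) / c1"
    using growth_in_Vu[OF c4_less_c3 order_refl t v] Iplus_le[of \<tau> "flow \<tau> t v"] t by simp
  then have "exp (mu * (t - \<tau>)) * (exp (mu * (\<tau> - t)) * Iplus t v)
      \<le> exp (mu * (t - \<tau>)) * (norm (flow \<tau> t v) / c1)"
    by (intro mult_left_mono) auto
  moreover have "exp (mu * (t - \<tau>)) * exp (mu * (\<tau> - t)) = 1"
    unfolding exp_add[symmetric] by (simp add: algebra_simps)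
  ultimately have "Iplus t v \<le> exp (mu * (t - \<tau>)) * (norm (flow \<tau> t v) / c1)"
    by (simp only: mult.assoc[symmetric] mult_1)
  then have "(1 + c3) / (c1 * c3) * Iplus t v
      \<le> (1 + c3) / (c1 * c3) * (exp (mu * (t - \<tau>)) * (norm (flow \<tau> t v) / c1))"
    using c_pos by (intro mult_left_mono) auto
  then show ?thesis using norm_le_in_Vu[OF t(1) v] by (simp add: power2_eq_square mult_ac)
qed

lemma has_dimension_Xu: "t \<ge> 0 \<Longrightarrow> has_dimension (Xu t) K"
proof -
  assume t: "t \<ge> 0"
  obtain B where B: "finite B" "independent B" "span B = initial_unstable" "card B = K"
    using initial_unstable(1) by (auto simp: has_dimension_def)
  have lin: "linear (blinfun_apply (T t 0))"
    by (simp add: blinfun.bounded_linear_right bounded_linear.linear)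
  have inj: "inj_on (blinfun_apply (T t 0)) (span B)"
    unfolding linear_inj_on_iff_eq_0[OF lin subspace_span]
  proof (intro ballI impI)
    fix v assume "v \<in> span B" "flow t 0 v = 0"
    then show "v = 0" using norm_flow_ge[of 0 t v] t initial_unstable(2) B(3) by auto
  qed
  have "independent (blinfun_apply (T t 0) ` B)"
    by (rule linear_independent_injective_image[OF lin B(2) inj])
  moreover have "card (blinfun_apply (T t 0) ` B) = K"
    using card_image[OF inj_on_subset[OF inj span_superset]] B(4) by simp
  moreover have "span (blinfun_apply (T t 0) ` B) = Xu t"
    by (simp add: linear_span_image[OF lin] B(3) Xu_def)
  ultimately show ?thesis using B(1) by (auto simp: has_dimension_def)
qed

lemma subspace_Xu: "t \<ge> 0 \<Longrightarrow> subspace (Xu t)"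
  using has_dimension_Xu[of t] unfolding has_dimension_def by (metis subspace_span)

lemma flow_image_Xu:
  assumes "0 \<le> t" "t \<le> \<tau>"
  shows "blinfun_apply (T \<tau> t) ` Xu t = Xu \<tau>"
  by (simp add: Xu_def image_image flow_flow assms)

lemma closed_Xu:
  assumes t: "t \<ge> 0"
  shows "closed (Xu t)"
proof (rule closed_of_separating_functionals[OF has_dimension_Xu[OF t]])
  fix w assume w: "w \<in> Xu t" "\<forall>k\<in>{1..K}. blinfun_apply (\<alpha> k t) w = 0"
  then have "Iplus t w = 0" using Iplus_eq_0_if[OF t] by blast
  then show "w = 0" using norm_le_in_Vu[OF t, of w] Xu_subset_Vu[OF t] w(1) by auto
qed

section \<open>Splitting by truncation at a finite time\<close>

text \<open>
  The truncated problem at time \<open>\<tau>\<close>: the kernel of \<open>I\<^sup>+\<close> at that time, pulled back to time \<open>t\<close>, has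
  codimension at most \<open>K\<close> and meets the \<open>K\<close>-dimensional unstable space only in \<open>0\<close>.
\<close>

lemma truncated_splitting:
  assumes t: "0 \<le> t" "t \<le> \<tau>"
  shows "\<exists>w\<in>Xu t. Iplus \<tau> (flow \<tau> t (v - w)) = 0"
proof -
  have \<tau>: "\<tau> \<ge> 0" using t by simp
  have "\<exists>w\<in>Xu t. \<forall>k\<in>{1..K}. (\<alpha> k \<tau> o\<^sub>L T \<tau> t) w = (\<alpha> k \<tau> o\<^sub>L T \<tau> t) v"
  proof (rule functionals_interpolate[OF has_dimension_Xu[OF t(1)]])
    show "linear (blinfun_apply (\<alpha> k \<tau> o\<^sub>L T \<tau> t))" for k
      by (simp add: blinfun.bounded_linear_right bounded_linear.linear)
    fix w assume w: "w \<in> Xu t" "\<forall>k\<in>{1..K}. (\<alpha> k \<tau> o\<^sub>L T \<tau> t) w = 0"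
    have wV: "w \<in> Vu c3 t" using Xu_subset_Vu[OF t(1)] w(1) by auto
    have "Iplus \<tau> (flow \<tau> t w) = 0" using Iplus_eq_0_if[OF \<tau>] w(2) by simp
    then have "exp (mu * (\<tau> - t)) * Iplus t w \<le> 0"
      using growth_in_Vu[OF c4_less_c3 order_refl t wV] by simp
    then have "Iplus t w = 0" using Iplus_nonneg[OF t(1), of w] by (simp add: mult_le_0_iff)
    then show "w = 0" using norm_le_in_Vu[OF t(1) wV] by simp
  qed
  then obtain w where w: "w \<in> Xu t" "\<forall>k\<in>{1..K}. (\<alpha> k \<tau> o\<^sub>L T \<tau> t) w = (\<alpha> k \<tau> o\<^sub>L T \<tau> t) v"
    by blast
  have "Iplus \<tau> (flow \<tau> t (v - w)) = 0"
    using w(2) by (intro Iplus_eq_0_if \<tau>) (simp add: blinfun.diff_right)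
  with w(1) show ?thesis by blast
qed

lemma flow_in_Vs_if_Iplus_eq_0:
  assumes t: "0 \<le> t" "t \<le> s" "s \<le> \<tau>" and v: "Iplus \<tau> (flow \<tau> t v) = 0"
  shows "flow s t v \<in> Vs c4 s"
proof (rule stable_cone_backward)
  have "0 \<le> c4 * Iminus \<tau> (flow \<tau> t v)" using Iminus_nonneg[of \<tau>] t c_pos by simp
  then show "flow \<tau> s (flow s t v) \<in> Vs c4 \<tau>" using v t by (simp add: flow_flow in_Vs)
qed (use t in auto)

text \<open>
  The difference \<open>w' - w\<close> lies in the unstable cone, so \<open>I\<^sup>+\<close> grows along it at rate \<open>mu\<close>. At
  time \<open>\<sigma>\<close> it equals the difference of the images of \<open>v - w\<close> and \<open>v - w'\<close>; there \<open>I\<^sup>+\<close> vanishes on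
  the first and is at most \<open>c4 * I\<^sup>-\<close> on the second, which has decayed at rate \<open>lam\<close>.
\<close>

lemma truncations_close:
  assumes t: "0 \<le> t" "t \<le> \<sigma>" "\<sigma> \<le> \<tau>"
    and w: "w \<in> Xu t" "Iplus \<sigma> (flow \<sigma> t (v - w)) = 0"
    and w': "w' \<in> Xu t" "Iplus \<tau> (flow \<tau> t (v - w')) = 0"
  shows "norm (w' - w) \<le> (1 + c3) / (c1 * c3) * (1 / c2)\<^sup>2 * c4 / c1 * (1 + gap_constant) * norm v
           * exp (- ((mu - lam) * (\<sigma> - t)))"
proof -
  have \<sigma>: "\<sigma> \<ge> 0" using t by simp
  define E where "E = exp (mu * (\<sigma> - t))"
  define F where "F = exp (lam * (\<sigma> - t))"
  have E0: "0 < E" by (simp add: E_def)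
  have dV: "w' - w \<in> Vu c3 t"
    using Xu_subset_Vu[OF t(1)] subspace_diff[OF subspace_Xu[OF t(1)] w'(1) w(1)] by auto
  have aV: "flow \<sigma> t (v - w') \<in> Vs c4 \<sigma>"
    by (rule flow_in_Vs_if_Iplus_eq_0[OF t w'(2)])
  have a: "norm (v - w') \<le> (1 + gap_constant) * norm v"
  proof -
    have "v - w' \<in> Vs c4 t"
      using flow_in_Vs_if_Iplus_eq_0[OF t(1) order_refl _ w'(2)] t by simp
    then have "norm w' \<le> gap_constant * norm v"
      using norm_unstable_part_le[OF t(1), of "v - w'" w'] Xu_subset_Vu[OF t(1)] w'(1) by auto
    then show ?thesis using norm_triangle_ineq4[of v w'] by (simp add: algebra_simps)
  qed
  have "Iminus \<sigma> (flow \<sigma> t (v - w')) \<le> F * ((1 + gap_constant) * norm v / c1)"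
  proof -
    have "Iminus t (v - w') \<le> (1 + gap_constant) * norm v / c1"
      using Iminus_le[OF t(1), of "v - w'"] divide_right_mono[OF a, of c1] c_pos by simp
    then have "F * Iminus t (v - w') \<le> F * ((1 + gap_constant) * norm v / c1)"
      by (intro mult_left_mono) (auto simp: F_def)
    then show ?thesis using decay_in_Vs[OF t(1,2) aV] by (simp add: F_def)
  qed
  then have Ia: "Iplus \<sigma> (flow \<sigma> t (v - w')) \<le> c4 * (F * ((1 + gap_constant) * norm v / c1))"
    using aV c_pos unfolding in_Vs by (meson less_imp_le mult_left_mono order_trans)
  have "flow \<sigma> t (w' - w) = flow \<sigma> t (v - w) - flow \<sigma> t (v - w')"
    by (simp add: blinfun.diff_right)
  then have "Iplus \<sigma> (flow \<sigma> t (w' - w)) \<le> (1 / c2)\<^sup>2 * Iplus \<sigma> (flow \<sigma> t (v - w'))"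
    using Iplus_diff_le[OF \<sigma>, of "flow \<sigma> t (v - w)" "flow \<sigma> t (v - w')"] w(2) by simp
  also have "\<dots> \<le> (1 / c2)\<^sup>2 * (c4 * (F * ((1 + gap_constant) * norm v / c1)))"
    using Ia by (intro mult_left_mono) auto
  finally have "E * Iplus t (w' - w) \<le> (1 / c2)\<^sup>2 * (c4 * (F * ((1 + gap_constant) * norm v / c1)))"
    using growth_in_Vu[OF c4_less_c3 order_refl t(1,2) dV] by (simp add: E_def)
  then have I: "Iplus t (w' - w) \<le> (1 / c2)\<^sup>2 * (c4 * (F * ((1 + gap_constant) * norm v / c1))) / E"
    by (subst pos_le_divide_eq[OF E0]) (simp only: mult.commute[of _ E])
  have "norm (w' - w) \<le> (1 + c3) / (c1 * c3) * Iplus t (w' - w)" by (rule norm_le_in_Vu[OF t(1) dV])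
  also have "\<dots> \<le> (1 + c3) / (c1 * c3) *
      ((1 / c2)\<^sup>2 * (c4 * (F * ((1 + gap_constant) * norm v / c1))) / E)"
    using c_pos by (intro mult_left_mono I) auto
  also have "\<dots> = (1 + c3) / (c1 * c3) * (1 / c2)\<^sup>2 * c4 / c1 * (1 + gap_constant) * norm v * (F / E)"
    by (simp only: divide_inverse mult_ac)
  also have "F / E = exp (- ((mu - lam) * (\<sigma> - t)))"
    unfolding E_def F_def exp_diff[symmetric] by (simp add: algebra_simps)
  finally show ?thesis .
qed

text \<open>
  The corrections for the truncation times \<open>t + n\<close> converge. Their limit stays in the unstable space,
  which is closed, and the limit of the differences keeps its orbit in the closed stable cones.
\<close>

lemma stable_unstable_splitting:
  assumes t: "t \<ge> 0"
  shows "\<exists>w\<in>Xu t. v - w \<in> Xs t"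
proof -
  have "\<exists>w\<in>Xu t. Iplus (t + real n) (flow (t + real n) t (v - w)) = 0" for n
    using truncated_splitting[OF t] by simp
  then obtain w where w: "\<And>n. w n \<in> Xu t"
    "\<And>n. Iplus (t + real n) (flow (t + real n) t (v - w n)) = 0"
    by metis
  define D where "D = (1 + c3) / (c1 * c3) * (1 / c2)\<^sup>2 * c4 / c1 * (1 + gap_constant) * norm v"
  define q where "q = exp (- (mu - lam))"
  have "exp (- ((mu - lam) * (t + real n - t))) = q ^ n" for n
    unfolding q_def exp_of_nat_mult[symmetric] by (simp add: algebra_simps)
  then have close: "norm (w m - w n) \<le> D * q ^ n" if "n \<le> m" for m n
    using truncations_close[OF t _ _ w(1)[of n] w(2)[of n] w(1)[of m] w(2)[of m]] that
    unfolding D_def by simp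
  have "(\<lambda>n. D * q ^ n) \<longlonglongrightarrow> D * 0"
    using exponents by (intro tendsto_mult tendsto_const LIMSEQ_realpow_zero) (auto simp: q_def)
  then have lim0: "(\<lambda>n. D * q ^ n) \<longlonglongrightarrow> 0" by simp
  have "Cauchy w"
  proof (rule CauchyI')
    fix e :: real assume "e > 0"
    then obtain N where N: "\<And>n. n \<ge> N \<Longrightarrow> D * q ^ n < e"
      using order_tendstoD(2)[OF lim0] by (auto simp: eventually_sequentially)
    then show "\<exists>M. \<forall>m\<ge>M. \<forall>n>m. dist (w m) (w n) < e"
    proof (intro exI[of _ N] allI impI)
      fix m n assume mn: "N \<le> m" "m < n"
      have "norm (w n - w m) \<le> D * q ^ m" using close[of m n] mn by simp
      then show "dist (w m) (w n) < e"
        using N[OF mn(1)] by (simp add: dist_norm norm_minus_commute)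
    qed
  qed
  then obtain l where l: "w \<longlonglongrightarrow> l" using Cauchy_convergent_iff convergent_def by blast
  have "l \<in> Xu t" by (rule closed_sequentially[OF closed_Xu[OF t] w(1) l])
  moreover have "v - l \<in> Xs t"
    unfolding Xs_iff[OF t]
  proof (intro allI impI)
    fix \<tau> assume \<tau>: "t \<le> \<tau>"
    have \<tau>0: "\<tau> \<ge> 0" using t \<tau> by simp
    have "(\<lambda>n. flow \<tau> t (v - w n)) \<longlonglongrightarrow> flow \<tau> t (v - l)"
      by (intro tendsto_intros l)
    moreover have "\<forall>\<^sub>F n in sequentially. flow \<tau> t (v - w n) \<in> Vs c4 \<tau>"
    proof -
      obtain N where N: "\<tau> - t \<le> real N" using real_arch_simple by blast
      have "flow \<tau> t (v - w n) \<in> Vs c4 \<tau>" if "n \<ge> N" for n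
        using that N by (intro flow_in_Vs_if_Iplus_eq_0[OF t \<tau> _ w(2)[of n]]) (simp add: algebra_simps)
      then show ?thesis by (auto simp: eventually_sequentially)
    qed
    ultimately show "flow \<tau> t (v - l) \<in> Vs c4 \<tau>"
      by (intro Lim_in_closed_set[OF closed_Vs[OF \<tau>0] _ trivial_limit_sequentially])
  qed
  ultimately show ?thesis by blast
qed

section \<open>The exponential dichotomy\<close>

lemma direct_sum_Xs_Xu:
  assumes t: "t \<ge> 0"
  shows "direct_sum (Xs t) (Xu t)"
  unfolding direct_sum_def
proof (intro conjI allI)
  show "Xs t \<inter> Xu t = {0}"
  proof (intro equalityI subsetI)
    fix w assume w: "w \<in> Xs t \<inter> Xu t"
    then have "- w \<in> Xs t" "w \<in> Xu t" using subspace_neg[OF subspace_Xs] by auto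
    then show "w \<in> {0}"
      using norm_unstable_part_le[OF t, of "- w" w] Xs_subset_Vs[OF t] Xu_subset_Vu[OF t] by auto
  qed (use subspace_0[OF subspace_Xs] subspace_0[OF subspace_Xu[OF t]] in auto)
  show "\<exists>s\<in>Xs t. \<exists>u\<in>Xu t. v = s + u" for v
    using stable_unstable_splitting[OF t, of v] by (metis diff_add_cancel)
qed (use subspace_Xs subspace_Xu[OF t] in auto)

lemma has_codimension_Xs: "t \<ge> 0 \<Longrightarrow> has_codimension (Xs t) K"
  unfolding has_codimension_def using direct_sum_Xs_Xu has_dimension_Xu by blast

lemma exponential_dichotomy_Xs_Xu: "exponential_dichotomy T lam mu Xs Xu"
proof -
  have "\<exists>P :: 'a \<Rightarrow>\<^sub>L 'a. (\<forall>v. blinfun_apply P v \<in> Xu t \<and> v - blinfun_apply P v \<in> Xs t) \<and>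
      norm P \<le> \<bar>gap_constant\<bar>" if t: "t \<ge> 0" for t
    using Xs_subset_Vs[OF t] Xu_subset_Vu[OF t]
    by (intro direct_sum_bounded_projection direct_sum_Xs_Xu[OF t] norm_unstable_part_le[OF t]) auto
  then obtain Pu where Pu: "\<And>t v. t \<ge> 0 \<Longrightarrow> blinfun_apply (Pu t) v \<in> Xu t"
    "\<And>t v. t \<ge> 0 \<Longrightarrow> v - blinfun_apply (Pu t) v \<in> Xs t"
    "\<And>t. t \<ge> 0 \<Longrightarrow> norm (Pu t :: 'a \<Rightarrow>\<^sub>L 'a) \<le> \<bar>gap_constant\<bar>"
    by metis
  define Ps where "Ps t = id_blinfun - Pu t" for t
  have Ps: "blinfun_apply (Ps t) v = v - blinfun_apply (Pu t) v" for t v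
    by (simp add: Ps_def blinfun.diff_left)
  define C where "C = max (1 + 2 * \<bar>gap_constant\<bar>)
      (max ((1 + c4) / c1\<^sup>2) ((1 + c3) / (c1\<^sup>2 * c3)))"
  have C: "1 + 2 * \<bar>gap_constant\<bar> \<le> C" "(1 + c4) / c1\<^sup>2 \<le> C" "(1 + c3) / (c1\<^sup>2 * c3) \<le> C"
    by (auto simp: C_def)
  have commute: "flow \<tau> t (blinfun_apply (Pu t) v) = blinfun_apply (Pu \<tau>) (flow \<tau> t v)"
    if t: "0 \<le> t" "t \<le> \<tau>" for t \<tau> v
  proof (rule direct_sum_unique[OF direct_sum_Xs_Xu])
    show "flow \<tau> t v - flow \<tau> t (blinfun_apply (Pu t) v) \<in> Xs \<tau>"
      using Xs_flow[OF t, of "v - blinfun_apply (Pu t) v"] Pu(2) t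
      by (simp add: blinfun.diff_right)
    show "flow \<tau> t (blinfun_apply (Pu t) v) \<in> Xu \<tau>" using flow_image_Xu[OF t] Pu(1) t by blast
  qed (use t Pu in auto)
  have norms: "norm (Ps t) + norm (Pu t) \<le> C" if "t \<ge> 0" for t
  proof -
    have "norm (Ps t) \<le> norm (id_blinfun :: 'a \<Rightarrow>\<^sub>L 'a) + norm (Pu t)"
      unfolding Ps_def by (rule norm_triangle_ineq4)
    also have "\<dots> \<le> 1 + norm (Pu t)"
      by (intro add_right_mono norm_blinfun_bound) auto
    finally show ?thesis using Pu(3)[OF that] C(1) by linarith
  qed
  have bij: "bij_betw (blinfun_apply (T \<tau> t)) (Xu t) (Xu \<tau>)" if t: "0 \<le> t" "t \<le> \<tau>" for t \<tau>
  proof -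
    have lin: "linear (blinfun_apply (T \<tau> t))"
      by (simp add: blinfun.bounded_linear_right bounded_linear.linear)
    have "inj_on (blinfun_apply (T \<tau> t)) (Xu t)"
      unfolding linear_inj_on_iff_eq_0[OF lin subspace_Xu[OF t(1)]]
    proof (intro ballI impI)
      fix v assume "v \<in> Xu t" "flow \<tau> t v = 0"
      then show "v = 0" using norm_flow_ge[OF t, of v] Xu_subset_Vu[OF t(1)] by auto
    qed
    then show ?thesis by (simp add: bij_betw_def flow_image_Xu[OF t])
  qed
  have stable: "norm (flow \<tau> t v) \<le> C * exp (lam * (\<tau> - t)) * norm v"
    if t: "0 \<le> t" "t \<le> \<tau>" and v: "v \<in> Xs t" for t \<tau> v
  proof -
    have "norm (flow \<tau> t v) \<le> (1 + c4) / c1\<^sup>2 * exp (lam * (\<tau> - t)) * norm v"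
      using norm_flow_le[OF t] Xs_iff[OF t(1)] v t by blast
    also have "\<dots> \<le> C * exp (lam * (\<tau> - t)) * norm v"
      by (intro mult_right_mono C) auto
    finally show ?thesis .
  qed
  have unstable: "norm (inv_into (Xu t) (blinfun_apply (T \<tau> t)) v) \<le> C * exp (mu * (t - \<tau>)) * norm v"
    if t: "0 \<le> t" "t \<le> \<tau>" and v: "v \<in> Xu \<tau>" for t \<tau> v
  proof -
    define u where "u = inv_into (Xu t) (blinfun_apply (T \<tau> t)) v"
    have im: "v \<in> blinfun_apply (T \<tau> t) ` Xu t" using v flow_image_Xu[OF t] by simp
    have u: "u \<in> Xu t" "flow \<tau> t u = v"
      unfolding u_def by (rule inv_into_into[OF im], rule f_inv_into_f[OF im])
    have "norm u \<le> (1 + c3) / (c1\<^sup>2 * c3) * exp (mu * (t - \<tau>)) * norm v"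
      using norm_flow_ge[OF t, of u] u Xu_subset_Vu[OF t(1)] by auto
    also have "\<dots> \<le> C * exp (mu * (t - \<tau>)) * norm v"
      by (intro mult_right_mono C) auto
    finally show ?thesis by (simp add: u_def)
  qed
  have comp_u: "T \<tau> t o\<^sub>L Pu t = Pu \<tau> o\<^sub>L T \<tau> t" if "0 \<le> t" "t \<le> \<tau>" for t \<tau>
    by (rule blinfun_eqI) (simp add: commute that)
  have comp_s: "T \<tau> t o\<^sub>L Ps t = Ps \<tau> o\<^sub>L T \<tau> t" if "0 \<le> t" "t \<le> \<tau>" for t \<tau>
    by (rule blinfun_eqI) (simp add: Ps commute that blinfun.diff_right)
  have parts: "\<forall>t\<ge>0. \<forall>v. blinfun_apply (Ps t) v \<in> Xs t \<and> blinfun_apply (Pu t) v \<in> Xu t \<and>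
      blinfun_apply (Ps t) v + blinfun_apply (Pu t) v = v"
    using Pu(1,2) by (simp add: Ps)
  show ?thesis
    unfolding exponential_dichotomy_def
    by (intro conjI exI[of _ Ps] exI[of _ Pu] exI[of _ C] parts)
       (simp_all add: exponents direct_sum_Xs_Xu comp_s comp_u norms bij stable unstable)
qed

end

text \<open>
  It remains to secure \<open>c4 < c3\<close>. If \<open>K \<ge> 1\<close>, a basis vector in the unstable cone has positive norm
  and positive pairing, so the two-sided bounds force \<open>c1 \<le> 1\<close> and \<open>c2 \<le> 1\<close>, and the smallness
  hypothesis gives \<open>c4 < c3\<close>. If \<open>K = 0\<close>, then \<open>I\<^sup>+ = 0\<close>, the growth hypothesis holds trivially
  for every opening, and \<open>c4\<close> may be replaced by some \<open>d \<le> c4\<close> below \<open>c3\<close>.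
\<close>

theorem theorem4:
  fixes T :: "real \<Rightarrow> real \<Rightarrow> 'a::banach \<Rightarrow>\<^sub>L 'a"
    and Iminus Iplus :: "real \<Rightarrow> 'a \<Rightarrow> real"
    and \<alpha> :: "nat \<Rightarrow> real \<Rightarrow> 'a \<Rightarrow>\<^sub>L real"
    and K :: nat
    and c1 c2 c3 c4 lam mu :: real
  assumes evolution: "strongly_continuous_evolution T"
    and Iminus_nonneg: "\<And>t v. t \<ge> 0 \<Longrightarrow> Iminus t v \<ge> 0"
    and Iplus_nonneg: "\<And>t v. t \<ge> 0 \<Longrightarrow> Iplus t v \<ge> 0"
    and Iminus_homogeneous: "\<And>t. t \<ge> 0 \<Longrightarrow> homogeneous (Iminus t)"
    and Iplus_homogeneous: "\<And>t. t \<ge> 0 \<Longrightarrow> homogeneous (Iplus t)"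
    and Iminus_continuous: "continuous_on ({0..} \<times> UNIV) (\<lambda>(t, v). Iminus t v)"
    and Iplus_continuous: "continuous_on ({0..} \<times> UNIV) (\<lambda>(t, v). Iplus t v)"
    and c_pos: "c1 > 0" "c2 > 0" "c3 > 0" "c4 > 0"
    and exponents: "lam < mu"
    and norm_equiv: "\<And>t v. t \<ge> 0 \<Longrightarrow>
          c1 * norm v \<le> Iminus t v + Iplus t v \<and> Iminus t v + Iplus t v \<le> 1 / c1 * norm v"
    and Iplus_equiv: "\<And>t v. t \<ge> 0 \<Longrightarrow>
          c2 * max_pairing K \<alpha> t v \<le> Iplus t v \<and> Iplus t v \<le> 1 / c2 * max_pairing K \<alpha> t v"
    and cone_dim: "\<And>t. t \<ge> 0 \<Longrightarrow>
          \<exists>W. has_dimension W K \<and> W \<subseteq> unstable_cone Iminus Iplus c3 t"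
    and c4_small: "c4 < 1 / 3 * (c1 * c2)\<^sup>2 * (c3 / (1 + c3))"
    and decay: "\<And>t \<tau> v. 0 \<le> t \<Longrightarrow> t \<le> \<tau> \<Longrightarrow>
          (\<And>t'. t' \<in> {t..\<tau>} \<Longrightarrow> blinfun_apply (T t' t) v \<in> stable_cone Iminus Iplus c3 t') \<Longrightarrow>
          Iminus \<tau> (blinfun_apply (T \<tau> t) v) \<le> exp (lam * (\<tau> - t)) * Iminus t v"
    and growth: "\<And>t \<tau> v. 0 \<le> t \<Longrightarrow> t \<le> \<tau> \<Longrightarrow>
          (\<And>t'. t' \<in> {t..\<tau>} \<Longrightarrow> blinfun_apply (T t' t) v \<in> unstable_cone Iminus Iplus c4 t') \<Longrightarrow>
          Iplus \<tau> (blinfun_apply (T \<tau> t) v) \<ge> exp (mu * (\<tau> - t)) * Iplus t v"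
  shows "\<exists>Xs Xu. exponential_dichotomy T lam mu Xs Xu \<and>
           (\<forall>t\<ge>0. Xs t \<subseteq> stable_cone Iminus Iplus c4 t \<and> has_codimension (Xs t) K)"
proof -
  have K0: "Iplus t v = 0" if "K = 0" "t \<ge> 0" for t v
    using Iplus_equiv[of t v] that by (simp add: max_pairing_def)
  define d where "d = (if K = 0 then min c4 (c3 / 2) else c4)"
  have d: "0 < d" "d \<le> c4" using c_pos by (auto simp: d_def)
  have d_less: "d < c3"
  proof (cases "K = 0")
    case True
    then show ?thesis using c_pos by (simp add: d_def min_less_iff_disj)
  next
    case False
    obtain W where W: "has_dimension W K" "W \<subseteq> unstable_cone Iminus Iplus c3 0"
      using cone_dim[of 0] by auto
    then obtain B where B: "independent B" "span B = W" "card B = K"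
      by (auto simp: has_dimension_def)
    then obtain b where b: "b \<in> B" using False by (metis card.empty equals0I)
    have b0: "b \<noteq> 0" using B(1) b dependent_zero by blast
    have bV: "c3 * Iminus 0 b \<le> Iplus 0 b"
      using W(2) span_base[OF b] B(2) by (auto simp: unstable_cone_def)
    have sum: "0 < Iminus 0 b + Iplus 0 b"
      using norm_equiv[of 0 b] b0 c_pos by (meson less_le_trans mult_pos_pos order_refl zero_less_norm_iff)
    have "Iplus 0 b \<noteq> 0"
    proof
      assume "Iplus 0 b = 0"
      then have "Iminus 0 b \<le> 0" using bV c_pos by (simp add: mult_le_0_iff)
      then show False using sum \<open>Iplus 0 b = 0\<close> by simp
    qed
    then have Ib: "0 < Iplus 0 b" using Iplus_nonneg[of 0 b] by simp
    \<comment> \<open>Two-sided bounds with reciprocal constants on a positive quantity force the constants to be at most 1.\<close>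
    have le_1: "c \<le> 1" if c: "0 < c" and x: "0 < x" "c * x \<le> 1 / c * x" for c x :: real
    proof -
      have "c * c \<le> 1" using c x by (simp add: field_simps)
      then show ?thesis using c by (metis abs_of_pos abs_square_le_1 power2_eq_square)
    qed
    have "c1 \<le> 1"
      using norm_equiv[of 0 b] b0 c_pos by (intro le_1[of c1 "norm b"]) auto
    moreover have "c2 \<le> 1"
    proof (rule le_1)
      have "0 < 1 / c2 * max_pairing K \<alpha> 0 b" using Iplus_equiv[of 0 b] Ib by linarith
      then show "0 < max_pairing K \<alpha> 0 b" using c_pos by (simp add: zero_less_divide_iff)
      show "c2 * max_pairing K \<alpha> 0 b \<le> 1 / c2 * max_pairing K \<alpha> 0 b"
        using Iplus_equiv[of 0 b] by (meson order_refl order_trans)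
    qed (use c_pos in auto)
    ultimately have "c1 * c2 \<le> 1" using c_pos by (simp add: mult_le_one)
    then have "(c1 * c2)\<^sup>2 \<le> 1" using c_pos by (simp add: power_le_one)
    then have "1 / 3 * (c1 * c2)\<^sup>2 * (c3 / (1 + c3)) \<le> 1 * (c3 / (1 + c3))"
      using c_pos by (intro mult_right_mono) auto
    also have "\<dots> \<le> c3" using c_pos by (simp add: field_simps)
    finally show ?thesis using c4_small d(2) by linarith
  qed
  interpret separated_cones T Iminus Iplus \<alpha> K c1 c2 c3 d lam mu
  proof
    show "d < 1 / 3 * (c1 * c2)\<^sup>2 * (c3 / (1 + c3))" using c4_small d(2) by linarith
    show "exp (mu * (\<tau> - t)) * Iplus t v \<le> Iplus \<tau> (blinfun_apply (T \<tau> t) v)"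
      if "0 \<le> t" "t \<le> \<tau>"
        and "\<And>t'. t' \<in> {t..\<tau>} \<Longrightarrow> blinfun_apply (T t' t) v \<in> unstable_cone Iminus Iplus d t'"
      for t \<tau> v
    proof (cases "K = 0")
      case True
      then show ?thesis using K0 that by simp
    next
      case False
      then show ?thesis using growth[OF that(1,2)] that(3) by (simp add: d_def)
    qed
  qed (fact assms d d_less)+
  have "Xs t \<subseteq> stable_cone Iminus Iplus c4 t" if "t \<ge> 0" for t
    using Xs_subset_Vs[OF that] Vs_mono[OF that d(2)] by blast
  then show ?thesis using exponential_dichotomy_Xs_Xu has_codimension_Xs by blast
qed

end
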